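(* Let $B=B(F)$ be a generalized stationary Bratteli diagram with vertex set $V_0$ and let $A=F^T$ have a Perron–Frobenius eigenpair $(\xi,\lambda)$, $A\xi=\lambda\xi$. Let $\mu$ be the tail invariant measure on the path space $X_B$ determined by $\mu([\overline e])=\xi_v/\lambda^{n}$ for every finite path $\overline e$ from level $V_0$ to $v\in V_n$. Let $\sigma : X_B\to X_B$ be the shift $\sigma(x_0,x_1,x_2,\ldots)=(x_1,x_2,\ldots)$. Then $\mu$ is $\sigma$-invariant (i.e. $\mu\circ\sigma^{-1}=\mu$) if and only if $H^{(1)}_v=\lambda$ for all $v\in V_0$, where $H^{(1)}_v=\sum_{w\in V_0}f_{v,w}$.
   Context: A generalized stationary Bratteli diagram $B=B(F)$ is defined as follows. Let $V_0$ be a countably infinite set (identified with $\mathbb N$ or $\mathbb Z$), and let $F=(f_{v,w})_{v,w\in V_0}$ be an infinite matrix (the incidence matrix) with entries in $\mathbb N_0=\{0,1,2,\ldots\}$ such that every row has only finitely many non-zero entries and every row and every column has at least one non-zero entry. The vertex set is $\mathcal V=\bigsqcup_{i\ge 0}V_i$ with $V_i=V_0$ for all $i$. Between level $V_i$ and level $V_{i+1}$ there are exactly $f_{v,w}$ edges from $w\in V_i$ to $v\in V_{i+1}$. The set of edges between consecutive levels does not depend on the level and is denoted $E$. For an edge $e$ from $w$ to $v$, $s(e)=w$ is its source and $r(e)=v$ its range. The path space $X_B$ is the set of all infinite sequences $x=(x_i)_{i\ge0}$ of edges with $r(x_i)=s(x_{i+1})$ for all $i\geq 0$. For a finite path $\overline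 e=(e_0,\ldots,e_n)$ the cylinder set is $[\overline e]=\{x\in X_B : x_0=e_0,\ldots,x_n=e_n\}$ (this path goes from level $V_0$ to level $V_{n+1}$); cylinder sets form a base of a Polish zero-dimensional topology on $X_B$. Standing assumptions of the paper: $X_B$ has no isolated points, and the tail equivalence relation ($x\sim y$ iff $x_i=y_i$ for all sufficiently large $i$) has no finite classes. The measure $\mu$ is defined under the assumptions that $A$ is irreducible, aperiodic and recurrent in the sense of Perron–Frobenius theory for countable matrices (with $\lambda=\lim_n (a^{(n)}_{vv})^{1/n}<\infty$ the Perron eigenvalue, $\sum_n a^{(n)}_{vv}\lambda^{-n}=\infty$, where $a^{(n)}_{vv}$ are the diagonal entries of $A^n$), and $\xi=(\xi_v)_{v\in V_0}$ is a right eigenvector with positive entries. The measure $\mu$ may be finite or $\sigma$-finite. A Borel measure is tail invariant if it takes equal values on cylinder sets $[\overline e]$, $[\overline e']$ of finite paths starting at level $0$ and ending at the same vertex of the same level. *)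

theory Defs
  imports "HOL-Analysis.Analysis"
begin

section \<open>Infinite non-negative integer matrices\<close>

definition mat_transpose :: "('v \<Rightarrow> 'v \<Rightarrow> nat) \<Rightarrow> 'v \<Rightarrow> 'v \<Rightarrow> nat" where
  "mat_transpose F = (\<lambda>v w. F w v)"

text \<open>The entries of the powers are sums over the whole index set. For the transpose of a matrix
  with finitely supported rows, which is the case used below, only finitely many summands are
  non-zero, so \<open>infsum\<close> is an ordinary finite sum. The same holds for \<open>row_sum\<close>.\<close>

primrec mat_power :: "('v \<Rightarrow> 'v \<Rightarrow> nat) \<Rightarrow> nat \<Rightarrow> 'v \<Rightarrow> 'v \<Rightarrow> nat" where
  "mat_power A 0 = (\<lambda>v w. if v = w then 1 else 0)"
| "mat_power A (Suc n) = (\<lambda>v w. \<Sum>\<^sub>\<infinity>u\<in>UNIV. A v u * mat_power A n u w)"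

definition irreducible_matrix :: "('v \<Rightarrow> 'v \<Rightarrow> nat) \<Rightarrow> bool" where
  "irreducible_matrix A \<longleftrightarrow> (\<forall>v w. \<exists>n>0. mat_power A n v w > 0)"

definition aperiodic_matrix :: "('v \<Rightarrow> 'v \<Rightarrow> nat) \<Rightarrow> bool" where
  "aperiodic_matrix A \<longleftrightarrow> (\<forall>v. Gcd {n. n > 0 \<and> mat_power A n v v > 0} = 1)"

definition perron_eigenvalue :: "('v \<Rightarrow> 'v \<Rightarrow> nat) \<Rightarrow> real \<Rightarrow> bool" where
  "perron_eigenvalue A lam \<longleftrightarrow>
     (\<forall>v. (\<lambda>n. root n (real (mat_power A n v v))) \<longlonglongrightarrow> lam)"

text \<open>\<open>recurrent_matrix A lam\<close> only has its usual meaning for the Perron eigenvalue \<open>lam\<close> of \<open>A\<close>.\<close>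

definition recurrent_matrix :: "('v \<Rightarrow> 'v \<Rightarrow> nat) \<Rightarrow> real \<Rightarrow> bool" where
  "recurrent_matrix A lam \<longleftrightarrow>
     (\<forall>v. \<not> summable (\<lambda>n. real (mat_power A n v v) / lam ^ n))"

definition perron_frobenius_eigenpair ::
  "('v \<Rightarrow> 'v \<Rightarrow> nat) \<Rightarrow> ('v \<Rightarrow> real) \<Rightarrow> real \<Rightarrow> bool" where
  "perron_frobenius_eigenpair A \<xi> lam \<longleftrightarrow>
     perron_eigenvalue A lam \<and> (\<forall>v. \<xi> v > 0) \<and>
     (\<forall>v. ((\<lambda>w. real (A v w) * \<xi> w) has_sum (lam * \<xi> v)) UNIV)"


section \<open>Generalized stationary Bratteli diagrams\<close>

definition incidence_matrix :: "('v \<Rightarrow> 'v \<Rightarrow> nat) \<Rightarrow> bool" where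
  "incidence_matrix F \<longleftrightarrow>
     (\<forall>v. finite {w. F v w \<noteq> 0}) \<and> (\<forall>v. \<exists>w. F v w \<noteq> 0) \<and> (\<forall>w. \<exists>v. F v w \<noteq> 0)"

text \<open>The triple \<open>(w, v, k)\<close> is the \<open>k\<close>-th of the \<open>F v w\<close> edges from \<open>w\<close> (in some level)
  to \<open>v\<close> (in the next level).\<close>

type_synonym 'v edge = "'v \<times> 'v \<times> nat"

definition src :: "'v edge \<Rightarrow> 'v" where
  "src e = fst e"

definition rng :: "'v edge \<Rightarrow> 'v" where
  "rng e = fst (snd e)"

definition edges :: "('v \<Rightarrow> 'v \<Rightarrow> nat) \<Rightarrow> 'v edge set" where
  "edges F = {(w, v, k). k < F v w}"

definition path_space :: "('v \<Rightarrow> 'v \<Rightarrow> nat) \<Rightarrow> (nat \<Rightarrow> 'v edge) set" where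
  "path_space F = {x. \<forall>i. x i \<in> edges F \<and> rng (x i) = src (x (Suc i))}"

text \<open>Finite paths start at level \<open>0\<close>; one with \<open>n\<close> edges ends at level \<open>n\<close>, in the vertex
  \<open>rng (last es)\<close>.\<close>

definition finite_path :: "('v \<Rightarrow> 'v \<Rightarrow> nat) \<Rightarrow> 'v edge list \<Rightarrow> bool" where
  "finite_path F es \<longleftrightarrow> es \<noteq> [] \<and> set es \<subseteq> edges F \<and>
     (\<forall>i. Suc i < length es \<longrightarrow> rng (es ! i) = src (es ! Suc i))"

definition cylinder :: "('v \<Rightarrow> 'v \<Rightarrow> nat) \<Rightarrow> 'v edge list \<Rightarrow> (nat \<Rightarrow> 'v edge) set" where
  "cylinder F es = {x \<in> path_space F. \<forall>i < length es. x i = es ! i}"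

definition path_topology :: "('v \<Rightarrow> 'v \<Rightarrow> nat) \<Rightarrow> (nat \<Rightarrow> 'v edge) topology" where
  "path_topology F = topology_generated_by (cylinder F ` {es. finite_path F es})"

definition no_isolated_points :: "'a topology \<Rightarrow> bool" where
  "no_isolated_points T \<longleftrightarrow> (\<forall>x \<in> topspace T. \<not> openin T {x})"

definition tail_equivalent :: "(nat \<Rightarrow> 'e) \<Rightarrow> (nat \<Rightarrow> 'e) \<Rightarrow> bool" where
  "tail_equivalent x y \<longleftrightarrow> (\<forall>\<^sub>F i in sequentially. x i = y i)"

definition no_finite_tail_classes :: "('v \<Rightarrow> 'v \<Rightarrow> nat) \<Rightarrow> bool" where
  "no_finite_tail_classes F \<longleftrightarrow>
     (\<forall>x \<in> path_space F. infinite {y \<in> path_space F. tail_equivalent x y})"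

definition row_sum :: "('v \<Rightarrow> 'v \<Rightarrow> nat) \<Rightarrow> 'v \<Rightarrow> nat" where
  "row_sum F v = (\<Sum>\<^sub>\<infinity>w\<in>UNIV. F v w)"


section \<open>Measures on the path space\<close>

definition path_borel :: "('v \<Rightarrow> 'v \<Rightarrow> nat) \<Rightarrow> (nat \<Rightarrow> 'v edge) measure" where
  "path_borel F = sigma (path_space F) {U. openin (path_topology F) U}"

definition tail_invariant ::
  "('v \<Rightarrow> 'v \<Rightarrow> nat) \<Rightarrow> (nat \<Rightarrow> 'v edge) measure \<Rightarrow> bool" where
  "tail_invariant F \<mu> \<longleftrightarrow>
     (\<forall>es es'. finite_path F es \<and> finite_path F es' \<and>
        length es = length es' \<and> rng (last es) = rng (last es') \<longrightarrow>
        emeasure \<mu> (cylinder F es) = emeasure \<mu> (cylinder F es'))"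

definition shift :: "(nat \<Rightarrow> 'e) \<Rightarrow> nat \<Rightarrow> 'e" where
  "shift x = (\<lambda>i. x (Suc i))"

end

theory Submission
  imports Defs
begin

text \<open>The preimage under the shift of the cylinder of a path starting at \<open>v\<close> is the disjoint union
  of the cylinders of its extensions by one of the \<open>row_sum F v\<close> edges ending at \<open>v\<close>. Each extension
  ends at the same vertex one level later, so the preimage has \<open>row_sum F v / lam\<close> times the measure
  of the cylinder. Since cylinders generate the Borel sets and are stable under intersection,
  invariance can be tested on them.\<close>

section \<open>Cylinder sets and the Borel sigma-algebra\<close>

lemma cylinder_subset: "cylinder F es \<subseteq> path_space F"
  by (auto simp: cylinder_def)

lemma finite_path_prefix:
  assumes "x \<in> path_space F" "n > 0"
  shows "finite_path F (map x [0..<n])"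
  using assms by (auto simp: finite_path_def path_space_def)

lemma mem_cylinder_prefix: "x \<in> path_space F \<Longrightarrow> x \<in> cylinder F (map x [0..<n])"
  by (auto simp: cylinder_def)

lemma cylinder_prefix_antimono:
  assumes "m \<le> n"
  shows "cylinder F (map x [0..<n]) \<subseteq> cylinder F (map x [0..<m])"
  using assms by (auto simp: cylinder_def)

text \<open>Like a ball in an ultrametric space, a cylinder can be recentred at any of its points.
  Cylinders with a common point thus become prefixes of one sequence, which makes them
  nested.\<close>

lemma cylinder_eq_prefix:
  assumes "x \<in> cylinder F es"
  shows "cylinder F es = cylinder F (map x [0..<length es])"
  using assms by (auto simp: cylinder_def)

lemma cylinder_Int_cases:
  "cylinder F es \<inter> cylinder F es' \<in> {{}, cylinder F es, cylinder F es'}"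
proof (cases "cylinder F es \<inter> cylinder F es' = {}")
  case False
  then obtain x where "x \<in> cylinder F es" "x \<in> cylinder F es'" by blast
  then have "cylinder F es = cylinder F (map x [0..<length es])"
    "cylinder F es' = cylinder F (map x [0..<length es'])"
    using cylinder_eq_prefix by blast+
  then have "cylinder F es \<subseteq> cylinder F es' \<or> cylinder F es' \<subseteq> cylinder F es"
    by (metis cylinder_prefix_antimono nle_le)
  then show ?thesis by blast
qed simp

text \<open>Two cylinders are nested or disjoint. The empty set is adjoined for the disjoint case,
  since it need not be the cylinder of a finite path.\<close>

lemma Int_stable_cylinders:
  "Int_stable (insert {} (cylinder F ` {es. finite_path F es}))"
proof (rule Int_stableI)
  fix a b
  assume "a \<in> insert {} (cylinder F ` {es. finite_path F es})"
    and "b \<in> insert {} (cylinder F ` {es. finite_path F es})"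
  then show "a \<inter> b \<in> insert {} (cylinder F ` {es. finite_path F es})"
    using cylinder_Int_cases[of F] by (elim insertE imageE) force+
qed

lemma path_space_eq_Union_edges: "path_space F = (\<Union>e\<in>edges F. cylinder F [e])"
  by (auto simp: cylinder_def path_space_def)

lemma finite_path_single: "finite_path F [e] \<longleftrightarrow> e \<in> edges F"
  by (auto simp: finite_path_def)

text \<open>The topology is given by a subbase; induction on the generation of \<open>U\<close>
  shows that cylinders around \<open>x\<close> form a local base. At an intersection the longer of
  the two prefixes serves both sets.\<close>

lemma openin_path_topology_prefix:
  assumes "openin (path_topology F) U" "x \<in> U"
  shows "x \<in> path_space F \<and> (\<exists>n. cylinder F (map x [0..<n]) \<subseteq> U)"
proof -
  have "generate_topology_on (cylinder F ` {es. finite_path F es}) U"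
    using assms(1) by (simp add: path_topology_def openin_topology_generated_by_iff)
  then show ?thesis using assms(2)
  proof (induction arbitrary: x rule: generate_topology_on.induct)
    case (Int a b)
    then obtain m n where
      "cylinder F (map x [0..<m]) \<subseteq> a" "cylinder F (map x [0..<n]) \<subseteq> b" "x \<in> path_space F"
      by blast
    moreover have "cylinder F (map x [0..<max m n]) \<subseteq> cylinder F (map x [0..<m])"
      "cylinder F (map x [0..<max m n]) \<subseteq> cylinder F (map x [0..<n])"
      by (simp_all add: cylinder_prefix_antimono)
    ultimately show ?case by blast
  next
    case (UN K)
    then show ?case by (meson UnionE Sup_upper subset_trans)
  next
    case (Basis s)
    then show ?case using cylinder_eq_prefix cylinder_subset by blast
  qed simp
qed

lemma openin_path_topology_subset: "openin (path_topology F) U \<Longrightarrow> U \<subseteq> path_space F"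
  using openin_path_topology_prefix by blast

lemma openin_cylinder: "finite_path F es \<Longrightarrow> openin (path_topology F) (cylinder F es)"
  unfolding path_topology_def by (intro topology_generated_by_Basis) auto

lemma openin_path_topology_eq_Union:
  assumes "openin (path_topology F) U"
  shows "U = (\<Union>es\<in>{es. finite_path F es \<and> cylinder F es \<subseteq> U}. cylinder F es)"
proof
  show "U \<subseteq> (\<Union>es\<in>{es. finite_path F es \<and> cylinder F es \<subseteq> U}. cylinder F es)"
  proof
    fix x assume "x \<in> U"
    then obtain n where x: "x \<in> path_space F" and n: "cylinder F (map x [0..<n]) \<subseteq> U"
      using openin_path_topology_prefix[OF assms] by blast
    \<comment> \<open>The prefix is lengthened by one edge because \<open>n\<close> may be 0, and
      the empty list is not a finite path.\<close>
    have "cylinder F (map x [0..<Suc n]) \<subseteq> U"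
      using n cylinder_prefix_antimono[of n "Suc n" F x] by simp
    moreover have "finite_path F (map x [0..<Suc n])"
      using x by (intro finite_path_prefix) auto
    ultimately show "x \<in> (\<Union>es\<in>{es. finite_path F es \<and> cylinder F es \<subseteq> U}. cylinder F es)"
      using mem_cylinder_prefix[OF x, of "Suc n"] by blast
  qed
qed blast

lemma space_path_borel: "space (path_borel F) = path_space F"
  unfolding path_borel_def by (rule space_measure_of) (auto dest: openin_path_topology_subset)

text \<open>Over countably many vertices there are only countably many finite paths, so writing an
  open set as a union of cylinders is a countable union. Hence cylinders generate all Borel
  sets.\<close>

lemma sets_path_borel:
  fixes F :: "'v::countable \<Rightarrow> 'v \<Rightarrow> nat"
  shows "sets (path_borel F) =
    sigma_sets (path_space F) (insert {} (cylinder F ` {es. finite_path F es}))"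
    (is "_ = sigma_sets ?\<Omega> ?E")
proof -
  have "sets (path_borel F) = sigma_sets ?\<Omega> {U. openin (path_topology F) U}"
    unfolding path_borel_def by (rule sets_measure_of) (auto dest: openin_path_topology_subset)
  also have "\<dots> = sigma_sets ?\<Omega> ?E"
  proof (rule sigma_sets_eqI)
    fix U assume "U \<in> {U. openin (path_topology F) U}"
    then have U: "U = (\<Union>es\<in>{es. finite_path F es \<and> cylinder F es \<subseteq> U}. cylinder F es)"
      using openin_path_topology_eq_Union by blast
    interpret sigma_algebra ?\<Omega> "sigma_sets ?\<Omega> ?E"
      by (rule sigma_algebra_sigma_sets) (use cylinder_subset in auto)
    have "(\<Union>es\<in>{es. finite_path F es \<and> cylinder F es \<subseteq> U}. cylinder F es) \<in> sigma_sets ?\<Omega> ?E"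
      by (intro countable_UN') auto
    then show "U \<in> sigma_sets ?\<Omega> ?E"
      using U by simp
  qed (auto intro: openin_cylinder sigma_sets.Empty)
  finally show ?thesis .
qed

section \<open>Preimages of cylinders under the shift\<close>

definition in_edges :: "('v \<Rightarrow> 'v \<Rightarrow> nat) \<Rightarrow> 'v \<Rightarrow> 'v edge set" where
  "in_edges F v = {e \<in> edges F. rng e = v}"

text \<open>Row \<open>v\<close> is finitely supported, so the \<open>infsum\<close> in
  \<open>row_sum\<close> collapses to a finite sum, which counts the triples
  \<open>(w, v, k)\<close> with \<open>k < F v w\<close>.\<close>

lemma finite_in_edges_and_card:
  assumes "incidence_matrix F"
  shows finite_in_edges: "finite (in_edges F v)"
    and card_in_edges: "card (in_edges F v) = row_sum F v"
proof -
  let ?W = "{w. F v w \<noteq> 0}" and ?g = "\<lambda>(w, k). (w, v, k)"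
  have W: "finite ?W"
    using assms by (simp add: incidence_matrix_def)
  have eq: "in_edges F v = ?g ` (SIGMA w:?W. {..<F v w})"
    by (force simp: in_edges_def edges_def rng_def)
  then show "finite (in_edges F v)"
    using W by simp
  have "inj_on ?g (SIGMA w:?W. {..<F v w})"
    by (auto simp: inj_on_def)
  then have "card (in_edges F v) = (\<Sum>w\<in>?W. F v w)"
    using W by (simp add: eq card_image)
  also have "\<dots> = (\<Sum>\<^sub>\<infinity>w\<in>?W. F v w)"
    using W by simp
  also have "\<dots> = row_sum F v"
    unfolding row_sum_def by (rule infsum_cong_neutral) auto
  finally show "card (in_edges F v) = row_sum F v" .
qed

lemma shift_in_path_space: "x \<in> path_space F \<Longrightarrow> shift x \<in> path_space F"
  by (simp add: path_space_def shift_def)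

lemma finite_path_Cons:
  assumes "finite_path F es" "e \<in> in_edges F (src (hd es))"
  shows "finite_path F (e # es)"
  using assms by (auto simp: finite_path_def in_edges_def nth_Cons hd_conv_nth split: nat.split)

text \<open>The condition on \<open>shift x\<close> fixes the edges of \<open>x\<close> from index 1
  on. The edge \<open>x 0\<close> stays free, except that it must end where \<open>es\<close>
  starts.\<close>

lemma vimage_shift_cylinder:
  assumes "finite_path F es"
  shows "shift -` cylinder F es \<inter> path_space F =
    (\<Union>e\<in>in_edges F (src (hd es)). cylinder F (e # es))"
proof (intro equalityI subsetI)
  fix x assume x: "x \<in> shift -` cylinder F es \<inter> path_space F"
  then have "x (Suc 0) = hd es"
    using assms by (auto simp: cylinder_def shift_def finite_path_def hd_conv_nth)
  then have "x 0 \<in> in_edges F (src (hd es))"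
    using x by (auto simp: in_edges_def path_space_def)
  moreover have "x \<in> cylinder F (x 0 # es)"
    using x by (auto simp: cylinder_def shift_def nth_Cons split: nat.split)
  ultimately show "x \<in> (\<Union>e\<in>in_edges F (src (hd es)). cylinder F (e # es))"
    by blast
next
  fix x assume "x \<in> (\<Union>e\<in>in_edges F (src (hd es)). cylinder F (e # es))"
  then show "x \<in> shift -` cylinder F es \<inter> path_space F"
    using shift_in_path_space[of x F] by (force simp: cylinder_def shift_def)
qed

lemma disjoint_family_cylinder_Cons:
  "disjoint_family_on (\<lambda>e. cylinder F (e # es)) I"
  by (force simp: disjoint_family_on_def cylinder_def)

lemma cylinder_in_sets:
  fixes F :: "'v::countable \<Rightarrow> 'v \<Rightarrow> nat"
  assumes "finite_path F es"
  shows "cylinder F es \<in> sets (path_borel F)"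
  using assms by (auto simp: sets_path_borel)

text \<open>It suffices to test the generators, and the preimage of a cylinder is a countable union
  of cylinders.\<close>

lemma measurable_shift:
  fixes F :: "'v::countable \<Rightarrow> 'v \<Rightarrow> nat"
  shows "shift \<in> measurable (path_borel F) (path_borel F)"
proof (rule measurable_sigma_sets[OF sets_path_borel])
  show "insert {} (cylinder F ` {es. finite_path F es}) \<subseteq> Pow (path_space F)"
    using cylinder_subset by blast
  show "shift \<in> space (path_borel F) \<rightarrow> path_space F"
    by (simp add: space_path_borel shift_in_path_space)
  fix y assume "y \<in> insert {} (cylinder F ` {es. finite_path F es})"
  then consider "y = {}" | es where "finite_path F es" "y = cylinder F es"
    by blast
  then show "shift -` y \<inter> space (path_borel F) \<in> sets (path_borel F)"
  proof cases
    case 2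
    then show ?thesis
      unfolding space_path_borel 2(2) vimage_shift_cylinder[OF 2(1)]
      by (intro sets.countable_UN'') (auto intro: cylinder_in_sets finite_path_Cons)
  qed simp
qed

section \<open>The image measure on cylinders and the invariance criterion\<close>

lemma emeasure_distr_shift_cylinder:
  fixes F :: "'v::countable \<Rightarrow> 'v \<Rightarrow> nat"
  assumes F: "incidence_matrix F"
    and sets: "sets \<mu> = sets (path_borel F)"
    and \<mu>: "\<And>es. finite_path F es \<Longrightarrow>
           emeasure \<mu> (cylinder F es) = ennreal (\<xi> (rng (last es)) / lam ^ length es)"
    and \<xi>: "\<And>v. \<xi> v > 0" and lam: "lam > 0"
    and es: "finite_path F es"
  shows "emeasure (distr \<mu> \<mu> shift) (cylinder F es) =
    ennreal (row_sum F (src (hd es)) / lam * (\<xi> (rng (last es)) / lam ^ length es))"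
proof -
  have "space \<mu> = path_space F"
    using sets_eq_imp_space_eq[OF sets] by (simp add: space_path_borel)
  moreover have "shift \<in> measurable \<mu> \<mu>"
    using measurable_shift measurable_cong_sets[OF sets sets] by blast
  ultimately have "emeasure (distr \<mu> \<mu> shift) (cylinder F es) =
      emeasure \<mu> (\<Union>e\<in>in_edges F (src (hd es)). cylinder F (e # es))"
    using es by (simp add: emeasure_distr sets cylinder_in_sets vimage_shift_cylinder)
  also have "\<dots> = (\<Sum>e\<in>in_edges F (src (hd es)). emeasure \<mu> (cylinder F (e # es)))"
    using es
    by (intro sum_emeasure[symmetric] disjoint_family_cylinder_Cons finite_in_edges F)
      (auto simp: sets intro: cylinder_in_sets finite_path_Cons)
  also have "\<dots> = (\<Sum>e\<in>in_edges F (src (hd es)).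
      ennreal (\<xi> (rng (last es)) / lam ^ Suc (length es)))"
  \<comment> \<open>Prepending \<open>e\<close> keeps the final vertex and raises its level by one,
    whence the extra factor \<open>lam\<close> in the denominator.\<close>
  proof (rule sum.cong)
    fix e assume "e \<in> in_edges F (src (hd es))"
    then show "emeasure \<mu> (cylinder F (e # es)) =
        ennreal (\<xi> (rng (last es)) / lam ^ Suc (length es))"
      using \<mu>[OF finite_path_Cons[OF es]] es by (simp add: finite_path_def)
  qed simp
  also have "\<dots> = ennreal (\<Sum>e\<in>in_edges F (src (hd es)).
      \<xi> (rng (last es)) / lam ^ Suc (length es))"
    using lam \<xi> by (intro sum_ennreal) (simp add: less_imp_le)
  \<comment> \<open>The summand does not depend on \<open>e\<close>, so the sum is its value times
    the number of edges into \<open>src (hd es)\<close>.\<close>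
  also have "\<dots> = ennreal (row_sum F (src (hd es)) / lam * (\<xi> (rng (last es)) / lam ^ length es))"
    by (simp add: card_in_edges[OF F] field_simps)
  finally show ?thesis .
qed

text \<open>Column \<open>v\<close> of \<open>F\<close> has a non-zero entry, so the eigenvector
  equation at \<open>v\<close> has a positive summand among non-negative ones. Thus
  \<open>lam * \<xi> v\<close> is positive, and so is \<open>lam\<close>.\<close>

lemma eigenvalue_pos:
  assumes "incidence_matrix F" "perron_frobenius_eigenpair (mat_transpose F) \<xi> lam"
  shows "lam > 0"
proof -
  fix v
  obtain w where w: "F w v \<noteq> 0"
    using assms(1) unfolding incidence_matrix_def by blast
  have \<xi>: "\<xi> u > 0" for u
    using assms(2) by (simp add: perron_frobenius_eigenpair_def)
  have "((\<lambda>w. real (F w v) * \<xi> w) has_sum (lam * \<xi> v)) UNIV"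
    using assms(2) by (simp add: perron_frobenius_eigenpair_def mat_transpose_def)
  then have "(\<Sum>u\<in>{w}. real (F u v) * \<xi> u) \<le> lam * \<xi> v"
    by (rule finite_sum_le_has_sum) (auto simp: \<xi> less_imp_le)
  moreover have "real (F w v) * \<xi> w > 0"
    using w \<xi> by simp
  ultimately have "lam * \<xi> v > 0"
    by simp
  then show ?thesis
    using \<xi>[of v] by (simp add: zero_less_mult_iff)
qed

theorem proposition2p18:
  fixes F :: "'v::countable \<Rightarrow> 'v \<Rightarrow> nat"
    and \<xi> :: "'v \<Rightarrow> real" and lam :: real
    and \<mu> :: "(nat \<Rightarrow> 'v edge) measure"
  assumes "infinite (UNIV :: 'v set)"
    and "incidence_matrix F"
    and "no_isolated_points (path_topology F)"
    and "no_finite_tail_classes F"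
    and "irreducible_matrix (mat_transpose F)"
    and "aperiodic_matrix (mat_transpose F)"
    and "recurrent_matrix (mat_transpose F) lam"
    and "perron_frobenius_eigenpair (mat_transpose F) \<xi> lam"
    and "sets \<mu> = sets (path_borel F)"
    and "tail_invariant F \<mu>"
    and "\<And>es. finite_path F es \<Longrightarrow>
           emeasure \<mu> (cylinder F es) = ennreal (\<xi> (rng (last es)) / lam ^ length es)"
  shows "distr \<mu> \<mu> shift = \<mu> \<longleftrightarrow> (\<forall>v. real (row_sum F v) = lam)"
proof
  note F = assms(2) and sets = assms(9) and cyl = assms(11)
  have lam: "lam > 0"
    using eigenvalue_pos assms(2,8) by blast
  have \<xi>: "\<xi> v > 0" for v
    using assms(8) by (simp add: perron_frobenius_eigenpair_def)
  have distr_cyl: "emeasure (distr \<mu> \<mu> shift) (cylinder F es) =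
      ennreal (row_sum F (src (hd es)) / lam * (\<xi> (rng (last es)) / lam ^ length es))"
    if "finite_path F es" for es
    using F sets cyl \<xi> lam that by (rule emeasure_distr_shift_cylinder)
  {
    assume inv: "distr \<mu> \<mu> shift = \<mu>"
    show "\<forall>v. real (row_sum F v) = lam"
    proof
      fix v
      \<comment> \<open>The factor for a cylinder depends only on the source of its path, so one
        edge leaving \<open>v\<close> isolates \<open>row_sum F v\<close>. Such an edge exists
        because column \<open>v\<close> is non-zero.\<close>
      obtain u where "F u v \<noteq> 0"
        using F unfolding incidence_matrix_def by blast
      then have path: "finite_path F [(v, u, 0)]"
        by (simp add: finite_path_single edges_def)
      have "ennreal (row_sum F v / lam * (\<xi> u / lam)) = ennreal (\<xi> u / lam)"
        using distr_cyl[OF path] cyl[OF path] by (simp add: inv src_def rng_def)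
      \<comment> \<open>Both sides are non-negative, where \<open>ennreal\<close> is injective; the
        positive factor \<open>\<xi> u / lam\<close> can then be cancelled.\<close>
      then have "row_sum F v / lam * (\<xi> u / lam) = \<xi> u / lam"
        using \<xi>[of u] lam by (subst (asm) ennreal_inj) (simp_all add: less_imp_le)
      then show "real (row_sum F v) = lam"
        using \<xi>[of u] lam by (simp add: field_simps)
    qed
  }
  {
    assume row: "\<forall>v. real (row_sum F v) = lam"
    let ?E = "insert {} (cylinder F ` {es. finite_path F es})"
    have \<mu>_sets: "sets \<mu> = sigma_sets (path_space F) ?E"
      using sets sets_path_borel by blast
    \<comment> \<open>As \<open>\<mu>\<close> may be infinite, agreement on an intersection-stable
      generator is combined with a countable cover by sets of finite measure: the cylinders of
      single edges.\<close>
    show "distr \<mu> \<mu> shift = \<mu>"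
    proof (rule measure_eqI_generator_eq_countable
        [where E = ?E and \<Omega> = "path_space F" and A = "(\<lambda>e. cylinder F [e]) ` edges F"])
      show "Int_stable ?E" by (rule Int_stable_cylinders)
      show "?E \<subseteq> Pow (path_space F)" using cylinder_subset by blast
      show "sets (distr \<mu> \<mu> shift) = sigma_sets (path_space F) ?E"
        and "sets \<mu> = sigma_sets (path_space F) ?E"
        by (simp_all add: \<mu>_sets)
      show "(\<lambda>e. cylinder F [e]) ` edges F \<subseteq> ?E"
        by (auto simp: finite_path_single)
      show "\<Union> ((\<lambda>e. cylinder F [e]) ` edges F) = path_space F"
        by (simp add: path_space_eq_Union_edges)
      show "countable ((\<lambda>e. cylinder F [e]) ` edges F)"
        by simp
      \<comment> \<open>With all row sums equal to \<open>lam\<close>, the factor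
        \<open>row_sum F (src (hd es)) / lam\<close> is 1.\<close>
      have eq: "emeasure (distr \<mu> \<mu> shift) (cylinder F es) = emeasure \<mu> (cylinder F es)"
        if "finite_path F es" for es
        using distr_cyl[OF that] cyl[OF that] row lam by simp
      then show "emeasure (distr \<mu> \<mu> shift) X = emeasure \<mu> X" if "X \<in> ?E" for X
        using that by auto
      \<comment> \<open>By \<open>eq\<close> this is the value of \<open>\<mu>\<close> on a
        cylinder, which is \<open>ennreal\<close> of a real number and hence finite.\<close>
      show "emeasure (distr \<mu> \<mu> shift) a \<noteq> \<infinity>" if "a \<in> (\<lambda>e. cylinder F [e]) ` edges F" for a
        using that by (auto simp: eq finite_path_single cyl)
    qed
  }
qed

end
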